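(* Let $G$ be a finite group. Then $box(R(G))=box(Pow(G))$ and $cub(R(G))=cub(Pow(G))$.
   Context: All graphs are finite, simple and undirected. Boxicity and cubicity: a $k$-box (resp. $k$-cube) is a Cartesian product of $k$ closed intervals (resp. closed unit-length intervals) of $\mathbb{R}$. A $k$-box (resp. $k$-cube) representation of a graph $\Gamma$ is a function $f$ assigning to each vertex a $k$-box (resp. $k$-cube) such that two distinct vertices $u,v$ are adjacent if and only if $f(u)\cap f(v)\neq\emptyset$. The boxicity $box(\Gamma)$ (resp. cubicity $cub(\Gamma)$) is the smallest non-negative integer $k$ for which $\Gamma$ has a $k$-box (resp. $k$-cube) representation; complete graphs have boxicity and cubicity $0$. The power graph $Pow(G)$ of a group $G$ is the graph with vertex set $G$ in which two distinct vertices $x,y$ are adjacent if $x=y^m$ or $y=x^m$ for some positive integer $m$. Define an equivalence relation on $G$ by $x\sim y$ if and only if $\langle x\rangle=\langle y\rangle$, and write $[x]$ for the class of $x$. The reduced power graph $R(G)$ has as vertices the equivalence classes of $\sim$; two distinct classes $[x],[y]$ are adjacent if and only if $\{x,y\}$ is an edge of $Pow(G)$ (this does not depend on the choice of representatives). *)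

theory Defs
  imports
    Complex_Main
    "HOL-Library.FuncSet"
    "HOL-Algebra.Multiplicative_Group"
    "Graph_Theory.Pair_Digraph"
begin

text \<open>
  Finite simple undirected graphs are the finite symmetric loop-free pair digraphs of
  \<^locale>\<open>pair_graph\<close>: an edge between \<open>u\<close> and \<open>v\<close> is the pair of arcs \<open>(u, v)\<close>, \<open>(v, u)\<close>.
\<close>


section \<open>Boxicity and cubicity\<close>

text \<open>
  Points of \<open>\<real>\<^sup>k\<close> are the extensional functions on \<open>{..<k}\<close>, so that \<open>k\<close> can be quantified over.
  Closed intervals are bounded and nonempty. For \<open>k = 0\<close> the only box is the one-point space
  (the empty product), hence complete graphs have boxicity and cubicity \<open>0\<close>.
\<close>

definition is_box :: "nat \<Rightarrow> (nat \<Rightarrow> real) set \<Rightarrow> bool" where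
  "is_box k B \<longleftrightarrow> (\<exists>a b. (\<forall>i<k. a i \<le> b i) \<and> B = (\<Pi>\<^sub>E i\<in>{..<k}. {a i..b i}))"

definition is_cube :: "nat \<Rightarrow> (nat \<Rightarrow> real) set \<Rightarrow> bool" where
  "is_cube k B \<longleftrightarrow> (\<exists>a. B = (\<Pi>\<^sub>E i\<in>{..<k}. {a i..a i + 1}))"

definition box_representation ::
    "nat \<Rightarrow> 'v pair_pre_digraph \<Rightarrow> ('v \<Rightarrow> (nat \<Rightarrow> real) set) \<Rightarrow> bool" where
  "box_representation k \<Gamma> f \<longleftrightarrow>
     (\<forall>v\<in>pverts \<Gamma>. is_box k (f v)) \<and>
     (\<forall>u\<in>pverts \<Gamma>. \<forall>v\<in>pverts \<Gamma>. u \<noteq> v \<longrightarrow> ((u, v) \<in> parcs \<Gamma> \<longleftrightarrow> f u \<inter> f v \<noteq> {}))"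

definition cube_representation ::
    "nat \<Rightarrow> 'v pair_pre_digraph \<Rightarrow> ('v \<Rightarrow> (nat \<Rightarrow> real) set) \<Rightarrow> bool" where
  "cube_representation k \<Gamma> f \<longleftrightarrow>
     (\<forall>v\<in>pverts \<Gamma>. is_cube k (f v)) \<and>
     (\<forall>u\<in>pverts \<Gamma>. \<forall>v\<in>pverts \<Gamma>. u \<noteq> v \<longrightarrow> ((u, v) \<in> parcs \<Gamma> \<longleftrightarrow> f u \<inter> f v \<noteq> {}))"

text \<open>
  \<open>LEAST\<close> is unspecified if there is no representation at all; the lemmas
  \<open>ex_cube_representation\<close> and \<open>ex_box_representation\<close> below exclude this for finite simple graphs.
\<close>

definition boxicity :: "'v pair_pre_digraph \<Rightarrow> nat" where
  "boxicity \<Gamma> = (LEAST k. \<exists>f. box_representation k \<Gamma> f)"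

definition cubicity :: "'v pair_pre_digraph \<Rightarrow> nat" where
  "cubicity \<Gamma> = (LEAST k. \<exists>f. cube_representation k \<Gamma> f)"

lemma is_cube_imp_is_box: "is_cube k B \<Longrightarrow> is_box k B"
proof -
  assume "is_cube k B"
  then obtain a where "B = (\<Pi>\<^sub>E i\<in>{..<k}. {a i..a i + 1})" by (auto simp: is_cube_def)
  then show "is_box k B"
    unfolding is_box_def by (intro exI[of _ a] exI[of _ "\<lambda>i. a i + 1"]) simp
qed

lemma cube_imp_box_representation: "cube_representation k \<Gamma> f \<Longrightarrow> box_representation k \<Gamma> f"
  unfolding cube_representation_def box_representation_def by (simp add: is_cube_imp_is_box)

lemma ex_cube_representation:
  assumes "pair_graph \<Gamma>"
  shows "\<exists>k f. cube_representation k \<Gamma> f"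
proof -
  interpret pair_graph \<Gamma> by fact
  have sym: "(v, u) \<in> parcs \<Gamma>" if "(u, v) \<in> parcs \<Gamma>" for u v
    using pair_sym_arcs that by (auto simp: symmetric_def dest: symD)
  obtain n :: nat and e where e: "pverts \<Gamma> = e ` {i. i < n}"
    using pair_finite_verts by (auto simp: finite_conv_nat_seg_image)
  define c :: "'a \<Rightarrow> nat \<Rightarrow> real" where
    "c v i = (if v = e i then 0 else if (v, e i) \<in> parcs \<Gamma> then 1 else 2)" for v i
  define f where "f v = (\<Pi>\<^sub>E i\<in>{..<n}. {c v i..c v i + 1})" for v
  have int: "f u \<inter> f v \<noteq> {} \<longleftrightarrow> (\<forall>i<n. c u i \<le> c v i + 1 \<and> c v i \<le> c u i + 1)" for u v
    by (auto simp: f_def PiE_Int PiE_eq_empty_iff)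
  have "(u, v) \<in> parcs \<Gamma> \<longleftrightarrow> f u \<inter> f v \<noteq> {}"
    if uv: "u \<in> pverts \<Gamma>" "v \<in> pverts \<Gamma>" "u \<noteq> v" for u v
  proof
    assume "(u, v) \<in> parcs \<Gamma>"
    then show "f u \<inter> f v \<noteq> {}"
      unfolding int using sym by (auto simp: c_def)
  next
    assume *: "f u \<inter> f v \<noteq> {}"
    obtain i where i: "i < n" "v = e i" using uv e by auto
    then have "c u i \<le> c v i + 1" using * int by blast
    then show "(u, v) \<in> parcs \<Gamma>"
      using uv i by (auto simp: c_def split: if_splits)
  qed
  then have "cube_representation n \<Gamma> f"
    unfolding cube_representation_def is_cube_def f_def by blast
  then show ?thesis by blast
qed

lemma ex_box_representation: "pair_graph \<Gamma> \<Longrightarrow> \<exists>k f. box_representation k \<Gamma> f"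
  using ex_cube_representation cube_imp_box_representation by blast


section \<open>Power graphs and reduced power graphs\<close>

definition power_graph :: "('a, 'b) monoid_scheme \<Rightarrow> 'a pair_pre_digraph" where
  "power_graph G =
     \<lparr> pverts = carrier G,
       parcs = {(x, y). x \<in> carrier G \<and> y \<in> carrier G \<and> x \<noteq> y \<and>
                  (\<exists>m::nat. m > 0 \<and> (x = y [^]\<^bsub>G\<^esub> m \<or> y = x [^]\<^bsub>G\<^esub> m))} \<rparr>"

definition cyc_rel :: "('a, 'b) monoid_scheme \<Rightarrow> 'a rel" where
  "cyc_rel G = {(x, y). x \<in> carrier G \<and> y \<in> carrier G \<and> generate G {x} = generate G {y}}"

definition reduced_power_graph :: "('a, 'b) monoid_scheme \<Rightarrow> 'a set pair_pre_digraph" where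
  "reduced_power_graph G =
     \<lparr> pverts = carrier G // cyc_rel G,
       parcs = {(cyc_rel G `` {x}, cyc_rel G `` {y}) | x y.
                  (x, y) \<in> parcs (power_graph G) \<and> cyc_rel G `` {x} \<noteq> cyc_rel G `` {y}} \<rparr>"

lemma equiv_cyc_rel: "equiv (carrier G) (cyc_rel G)"
  by (rule equivI) (auto simp: cyc_rel_def refl_on_def sym_def trans_def)

lemma pair_graph_power_graph:
  assumes "finite (carrier G)"
  shows "pair_graph (power_graph G)"
proof unfold_locales
  show "finite (parcs (power_graph G))"
    by (rule finite_subset[of _ "carrier G \<times> carrier G"]) (use assms in \<open>auto simp: power_graph_def\<close>)
qed (use assms in \<open>auto simp: power_graph_def symmetric_def sym_def\<close>)

lemma pair_graph_reduced_power_graph: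
  assumes "finite (carrier G)"
  shows "pair_graph (reduced_power_graph G)"
proof -
  have fin: "finite (carrier G // cyc_rel G)"
    using assms by (simp add: quotient_def)
  have sub: "parcs (reduced_power_graph G) \<subseteq> (carrier G // cyc_rel G) \<times> (carrier G // cyc_rel G)"
    by (auto simp: reduced_power_graph_def power_graph_def intro!: quotientI)
  have verts: "pverts (reduced_power_graph G) = carrier G // cyc_rel G"
    by (simp add: reduced_power_graph_def)
  have loopfree: "fst e \<noteq> snd e" if "e \<in> parcs (reduced_power_graph G)" for e
    using that by (auto simp: reduced_power_graph_def)
  have sym: "sym (parcs (power_graph G))"
    by (auto simp: power_graph_def sym_def)
  show ?thesis
  proof unfold_locales
    show "finite (parcs (reduced_power_graph G))"
      using finite_subset[OF sub] fin by simp
    have "sym (parcs (reduced_power_graph G))"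
    proof (rule symI)
      fix A B assume "(A, B) \<in> parcs (reduced_power_graph G)"
      then obtain x y where "A = cyc_rel G `` {x}" "B = cyc_rel G `` {y}" "A \<noteq> B"
          "(x, y) \<in> parcs (power_graph G)"
        by (auto simp: reduced_power_graph_def)
      moreover from this have "(y, x) \<in> parcs (power_graph G)" using sym by (blast dest: symD)
      ultimately show "(B, A) \<in> parcs (reduced_power_graph G)"
        unfolding reduced_power_graph_def by auto
    qed
    then show "symmetric (with_proj (reduced_power_graph G))"
      by (simp add: symmetric_def)
  qed (use fin sub loopfree in \<open>auto simp: verts\<close>)
qed

text \<open>Adjacency in the reduced power graph does not depend on the representatives.\<close>

lemma (in group) parcs_power_graph_iff:
  assumes "finite (carrier G)" "x \<in> carrier G" "y \<in> carrier G"
  shows "(x, y) \<in> parcs (power_graph G) \<longleftrightarrow>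
    x \<noteq> y \<and> (generate G {x} \<subseteq> generate G {y} \<or> generate G {y} \<subseteq> generate G {x})"
proof -
  have pw: "(\<exists>m::nat. m > 0 \<and> a = b [^] m) \<longleftrightarrow> generate G {a} \<subseteq> generate G {b}"
    if ab: "a \<in> carrier G" "b \<in> carrier G" for a b
  proof
    assume "\<exists>m::nat. m > 0 \<and> a = b [^] m"
    then have "a \<in> generate G {b}"
      using generate_pow_on_finite_carrier[OF assms(1) ab(2)] by auto
    then show "generate G {a} \<subseteq> generate G {b}"
      using generate_subgroup_incl[of "{a}" "generate G {b}"] generate_is_subgroup[of "{b}"] ab
      by simp
  next
    assume "generate G {a} \<subseteq> generate G {b}"
    then have "a \<in> generate G {b}" using generate.incl[of a "{a}"] by auto
    then obtain k :: nat where k: "a = b [^] k"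
      using generate_pow_on_finite_carrier[OF assms(1) ab(2)] by auto
    have "b [^] (k + ord b) = a"
      using ab k by (simp flip: nat_pow_mult)
    moreover have "ord b > 0" using ord_ge_1[OF assms(1) ab(2)] by simp
    ultimately show "\<exists>m::nat. m > 0 \<and> a = b [^] m"
      by (metis add_gr_0)
  qed
  show ?thesis
    using assms pw[of x y] pw[of y x] by (auto simp: power_graph_def)
qed

lemma (in group) parcs_reduced_power_graph_iff:
  assumes "finite (carrier G)" "x \<in> carrier G" "y \<in> carrier G"
  shows "(cyc_rel G `` {x}, cyc_rel G `` {y}) \<in> parcs (reduced_power_graph G) \<longleftrightarrow>
    cyc_rel G `` {x} \<noteq> cyc_rel G `` {y} \<and> (x, y) \<in> parcs (power_graph G)"
    (is "?L \<longleftrightarrow> ?R")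
proof
  assume ?L
  then obtain u v where uv: "cyc_rel G `` {x} = cyc_rel G `` {u}" "cyc_rel G `` {y} = cyc_rel G `` {v}"
      "(u, v) \<in> parcs (power_graph G)" "cyc_rel G `` {u} \<noteq> cyc_rel G `` {v}"
    by (auto simp: reduced_power_graph_def)
  have c: "u \<in> carrier G" "v \<in> carrier G" using uv(3) by (auto simp: power_graph_def)
  have "generate G {x} = generate G {u}" "generate G {y} = generate G {v}"
    using uv(1,2) eq_equiv_class_iff[OF equiv_cyc_rel] c assms by (auto simp: cyc_rel_def)
  then show ?R
    using uv parcs_power_graph_iff[OF assms(1)] c assms by auto
next
  assume ?R
  then show ?L by (auto simp: reduced_power_graph_def)
qed

end

(* The reduced power graph is the quotient of the power graph by a relation whose classes are
   cliques and across which adjacency does not depend on representatives. Intersection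
   representations by nonempty sets therefore pull back along the quotient map, and conversely
   restrict to a set of representatives. *)
theory Submission
  imports Defs
begin

text \<open>The predicate \<open>P\<close> is left abstract so that boxes and cubes become two
  instances of one argument. Hypothesis \<open>adj\<close> says that each fibre of \<open>q\<close>
  is a clique and that adjacency between different fibres is read off from \<open>F\<close>.\<close>

lemma intersection_representation_quotient_iff:
  assumes surj: "q ` V = W"
    and adj: "\<And>u v. u \<in> V \<Longrightarrow> v \<in> V \<Longrightarrow> u \<noteq> v \<Longrightarrow> (u, v) \<in> E \<longleftrightarrow> q u = q v \<or> (q u, q v) \<in> F"
    and nonempty: "\<And>B. P B \<Longrightarrow> B \<noteq> {}"
  shows "(\<exists>f. (\<forall>w\<in>W. P (f w)) \<and> (\<forall>w\<in>W. \<forall>z\<in>W. w \<noteq> z \<longrightarrow> ((w, z) \<in> F \<longleftrightarrow> f w \<inter> f z \<noteq> {})))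
     \<longleftrightarrow> (\<exists>f. (\<forall>u\<in>V. P (f u)) \<and> (\<forall>u\<in>V. \<forall>v\<in>V. u \<noteq> v \<longrightarrow> ((u, v) \<in> E \<longleftrightarrow> f u \<inter> f v \<noteq> {})))"
    (is "(\<exists>f. ?R f) \<longleftrightarrow> (\<exists>f. ?S f)")
proof
  assume "\<exists>f. ?R f"
  then obtain f where f: "?R f" by blast
  have "(u, v) \<in> E \<longleftrightarrow> f (q u) \<inter> f (q v) \<noteq> {}" if uv: "u \<in> V" "v \<in> V" "u \<noteq> v" for u v
  proof (cases "q u = q v")
    case True
    \<comment> \<open>Adjacent vertices of one fibre receive the same set, which meets itself
      exactly because it is nonempty.\<close>
    moreover have "f (q v) \<noteq> {}"
      using f nonempty surj uv(2) by blast
    ultimately show ?thesis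
      using adj[OF uv] by simp
  next
    case False
    then show ?thesis
      using adj[OF uv] f surj uv(1,2) by (metis imageI)
  qed
  then have "?S (f \<circ> q)"
    using f surj by auto
  then show "\<exists>f. ?S f" by blast
next
  assume "\<exists>f. ?S f"
  then obtain f where f: "?S f" by blast
  \<comment> \<open>A section of \<open>q\<close>, choosing one representative in each
    fibre.\<close>
  define s where "s = inv_into V q"
  have s: "s w \<in> V" "q (s w) = w" if "w \<in> W" for w
    using that surj by (auto simp: s_def inv_into_into f_inv_into_f)
  \<comment> \<open>Representatives of distinct \<open>w\<close>, \<open>z\<close> are distinct and
    lie in different fibres, so the alternative \<open>q u = q v\<close> in \<open>adj\<close> drops
    out.\<close>
  have "(w, z) \<in> F \<longleftrightarrow> f (s w) \<inter> f (s z) \<noteq> {}" if "w \<in> W" "z \<in> W" "w \<noteq> z" for w z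
    using that s[of w] s[of z] adj[of "s w" "s z"] f by metis
  then have "?R (f \<circ> s)"
    using f s by auto
  then show "\<exists>f. ?R f" by blast
qed

lemma is_box_nonempty: "is_box k B \<Longrightarrow> B \<noteq> {}"
  by (auto simp: is_box_def PiE_eq_empty_iff)

lemma is_cube_nonempty: "is_cube k B \<Longrightarrow> B \<noteq> {}"
  using is_box_nonempty is_cube_imp_is_box by blast

text \<open>Both graphs admit representations in exactly the same dimensions \<open>k\<close>, so
  the two \<open>LEAST\<close> expressions range over the same predicate.\<close>

lemma
  assumes "q ` pverts \<Gamma> = pverts \<Delta>"
    and "\<And>u v. u \<in> pverts \<Gamma> \<Longrightarrow> v \<in> pverts \<Gamma> \<Longrightarrow> u \<noteq> v \<Longrightarrow>
           (u, v) \<in> parcs \<Gamma> \<longleftrightarrow> q u = q v \<or> (q u, q v) \<in> parcs \<Delta>"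
  shows boxicity_quotient: "boxicity \<Delta> = boxicity \<Gamma>"
    and cubicity_quotient: "cubicity \<Delta> = cubicity \<Gamma>"
proof -
  have "(\<exists>f. box_representation k \<Delta> f) \<longleftrightarrow> (\<exists>f. box_representation k \<Gamma> f)" for k
    unfolding box_representation_def
    by (rule intersection_representation_quotient_iff[OF assms]) (auto dest: is_box_nonempty)
  then show "boxicity \<Delta> = boxicity \<Gamma>"
    by (simp add: boxicity_def)
  have "(\<exists>f. cube_representation k \<Delta> f) \<longleftrightarrow> (\<exists>f. cube_representation k \<Gamma> f)" for k
    unfolding cube_representation_def
    by (rule intersection_representation_quotient_iff[OF assms]) (auto dest: is_cube_nonempty)
  then show "cubicity \<Delta> = cubicity \<Gamma>"
    by (simp add: cubicity_def)
qed

text \<open>This brings adjacency into the form of \<open>adj\<close>. Distinct generators of the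
  same cyclic subgroup are positive powers of each other, so every class is a clique; between
  different classes adjacency is independent of representatives.\<close>

lemma (in group) parcs_power_graph_iff_reduced:
  assumes "finite (carrier G)" "x \<in> carrier G" "y \<in> carrier G" "x \<noteq> y"
  shows "(x, y) \<in> parcs (power_graph G) \<longleftrightarrow>
    cyc_rel G `` {x} = cyc_rel G `` {y} \<or>
    (cyc_rel G `` {x}, cyc_rel G `` {y}) \<in> parcs (reduced_power_graph G)"
proof (cases "cyc_rel G `` {x} = cyc_rel G `` {y}")
  case True
  then have "generate G {x} = generate G {y}"
    using eq_equiv_class_iff[OF equiv_cyc_rel assms(2,3)] by (simp add: cyc_rel_def)
  then show ?thesis
    using True parcs_power_graph_iff[OF assms(1-3)] assms(4) by simp
next
  case False
  then show ?thesis
    using parcs_reduced_power_graph_iff[OF assms(1-3)] by simp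
qed

theorem mainTheorem5:
  fixes G :: "('a, 'b) monoid_scheme"
  assumes "group G"
    and "finite (carrier G)"
  shows "boxicity (reduced_power_graph G) = boxicity (power_graph G)
       \<and> cubicity (reduced_power_graph G) = cubicity (power_graph G)"
proof -
  \<comment> \<open>The fibres of this class map on \<open>carrier G\<close> are the sets of
    generators of the cyclic subgroups.\<close>
  let ?q = "\<lambda>x. cyc_rel G `` {x}"
  have verts: "?q ` pverts (power_graph G) = pverts (reduced_power_graph G)"
    by (auto simp: power_graph_def reduced_power_graph_def quotient_def)
  have "(x, y) \<in> parcs (power_graph G) \<longleftrightarrow>
      ?q x = ?q y \<or> (?q x, ?q y) \<in> parcs (reduced_power_graph G)"
    if "x \<in> pverts (power_graph G)" "y \<in> pverts (power_graph G)" "x \<noteq> y" for x y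
    using group.parcs_power_graph_iff_reduced[OF assms] that by (simp add: power_graph_def)
  then show ?thesis
    using boxicity_quotient[OF verts] cubicity_quotient[OF verts] by blast
qed

end
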